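(* For each non-negative integer $N$, $$\begin{aligned} T(1,1,2;4N)&=Rt(1,2,1;N),\\ T(1,1,2;4N+1)&=2\,rT(2,1,2;N),\\ T(1,1,2;4N+2)&=2\,rT(1,1,4;N),\\ T(1,1,2;4N+3)&=4\,T(1,2,4;N),\\ r(1,2,4;2N)&=r(1,2,2;N),\\ r(1,2,4;2N+1)&=2\,T(1,1,2;N). \end{aligned}$$
   Context: $\mathbb{N}_0=\{0,1,2,\dots\}$ and $t_n=n(n+1)/2$ (triangular numbers). For positive integers $a_1,a_2,a_3$ and $N\in\mathbb{N}_0$: $r(a_1,a_2,a_3;N)=|\{(l,m,n)\in\mathbb{Z}^3: N=a_1l^2+a_2m^2+a_3n^2\}|$; $T(a_1,a_2,a_3;N)=|\{(l,m,n)\in\mathbb{N}_0^3: N=a_1t_l+a_2t_m+a_3t_n\}|$; $Rt(a_1,a_2,a_3;N)=|\{(l,m,n)\in\mathbb{Z}^2\times\mathbb{N}_0: N=a_1l^2+a_2m^2+a_3t_n\}|$; $rT(a_1,a_2,a_3;N)=|\{(l,m,n)\in\mathbb{Z}\times\mathbb{N}_0^2: N=a_1l^2+a_2t_m+a_3t_n\}|$. *)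

theory Defs
  imports Main
begin

definition tri :: "nat \<Rightarrow> nat" where
  "tri n = n * (n + 1) div 2"

text \<open>
  The coefficients are meant to be positive. In that case each of the sets below is finite, so
  \<open>card\<close> is the true number of representations (\<open>card\<close> of an infinite set would be 0).
\<close>

definition r :: "nat \<Rightarrow> nat \<Rightarrow> nat \<Rightarrow> nat \<Rightarrow> nat" where
  "r a1 a2 a3 N = card {(l :: int, m :: int, n :: int).
     int N = int a1 * l^2 + int a2 * m^2 + int a3 * n^2}"

definition T :: "nat \<Rightarrow> nat \<Rightarrow> nat \<Rightarrow> nat \<Rightarrow> nat" where
  "T a1 a2 a3 N = card {(l :: nat, m :: nat, n :: nat).
     N = a1 * tri l + a2 * tri m + a3 * tri n}"

definition Rt :: "nat \<Rightarrow> nat \<Rightarrow> nat \<Rightarrow> nat \<Rightarrow> nat" where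
  "Rt a1 a2 a3 N = card {(l :: int, m :: int, n :: nat).
     int N = int a1 * l^2 + int a2 * m^2 + int a3 * int (tri n)}"

definition rT :: "nat \<Rightarrow> nat \<Rightarrow> nat \<Rightarrow> nat \<Rightarrow> nat" where
  "rT a1 a2 a3 N = card {(l :: int, m :: nat, n :: nat).
     int N = int a1 * l^2 + int a2 * int (tri m) + int a3 * int (tri n)}"

end

theory Submission
  imports Defs
begin

text \<open>
  With \<open>\<phi>(q) = \<Sum> q^(n^2)\<close> over the integers and \<open>\<psi>(q) = \<Sum> q^(t_n)\<close> over the naturals, everything follows
  from \<open>\<psi>(q)^2 = \<phi>(q) \<psi>(q^2)\<close> and \<open>\<phi>(q) = \<phi>(q^4) + 2 q \<psi>(q^8)\<close>. The former, applied twice,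
  gives \<open>\<psi>(q)^2 \<psi>(q^2) = \<phi>(q) \<phi>(q^2) \<psi>(q^4)\<close>; the latter then separates the residue
  classes of the exponents. Both identities are realised by bijections of the index sets.
\<close>

lemma two_tri: "2 * int (tri n) = int n * (int n + 1)"
proof -
  have "2 * tri n = n * (n + 1)"
    unfolding tri_def by simp
  then have "int (2 * tri n) = int (n * (n + 1))"
    by (rule arg_cong)
  then show ?thesis
    by (simp add: algebra_simps)
qed

text \<open>Extending \<open>t\<close> to the integers, \<open>t_i = t_(-1-i)\<close>; \<open>fold_int\<close> picks the nonnegative index.\<close>

definition fold_int :: "int \<Rightarrow> nat" where
  "fold_int i = (if 0 \<le> i then nat i else nat (-1 - i))"

lemma two_tri_fold_int: "2 * int (tri (fold_int i)) = i * (i + 1)"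
  by (simp add: two_tri fold_int_def algebra_simps)

lemma fold_int_eq_iff: "fold_int i = fold_int j \<longleftrightarrow> i = j \<or> i + j = -1"
  unfolding fold_int_def by auto

lemma fold_int_of_nat [simp]: "fold_int (int n) = n"
  and fold_int_neg [simp]: "fold_int (-1 - int n) = n"
  by (simp_all add: fold_int_def)

text \<open>This is the index map behind psi(q)^2 = phi(q) psi(q^2): over the integers, t_(k+x) +
  t_(k-x) = x^2 + 2 t_k.\<close>

definition tri_pair :: "int \<times> nat \<Rightarrow> nat \<times> nat" where
  "tri_pair = (\<lambda>(x, k). (fold_int (int k + x), fold_int (int k - x)))"

lemma tri_add_tri_pair:
  assumes "tri_pair (x, k) = (l, m)"
  shows "int (tri l) + int (tri m) = x^2 + 2 * int (tri k)"
proof -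
  have "2 * int (tri l) = (int k + x) * (int k + x + 1)"
    and "2 * int (tri m) = (int k - x) * (int k - x + 1)"
    using assms two_tri_fold_int by (auto simp: tri_pair_def)
  with two_tri[of k] show ?thesis
    by (simp add: algebra_simps power2_eq_square)
qed

text \<open>Two index pairs with the same image agree up to reflection in each coordinate. One
  reflected coordinate violates parity, and two would force the \<open>k\<close> values to sum to
  -1.\<close>

lemma inj_tri_pair: "inj tri_pair"
  by (rule injI) (auto simp: tri_pair_def fold_int_eq_iff; presburger)

text \<open>A preimage needs integer lifts of \<open>l\<close> and \<open>m\<close> with an even sum
  \<open>2 * k\<close>, where \<open>k\<close> is nonnegative. If \<open>l + m\<close> is odd,
  reflecting the smaller index to \<open>-1 - i\<close> flips its parity and keeps the sum
  nonnegative.\<close>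

lemma surj_tri_pair: "surj tri_pair"
proof -
  have "(l, m) \<in> range tri_pair" for l m
  proof (cases "even (l + m)")
    case True
    then obtain k where k: "l + m = 2 * k"
      by (elim evenE)
    then have "int k - (int l - int k) = int m"
      by linarith
    then have "tri_pair (int l - int k, k) = (fold_int (int l), fold_int (int m))"
      unfolding tri_pair_def by simp
    then show ?thesis
      by (metis fold_int_of_nat rangeI)
  next
    case False
    show ?thesis
    proof (cases "m < l")
      case True
      with False obtain k where k: "l = m + 2 * k + 1"
        by (metis add.commute add.left_commute even_add less_imp_add_positive oddE)
      then have "tri_pair (int l - int k, k) = (fold_int (int l), fold_int (-1 - int m))"
        unfolding tri_pair_def by (auto intro!: arg_cong[where f = fold_int])
      then show ?thesis
        by (metis fold_int_of_nat fold_int_neg rangeI)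
    next
      case neg: False
      with False have "l < m" "odd (m - l)"
        by (auto intro: linorder_neqE_nat)
      then obtain k where k: "m = l + 2 * k + 1"
        by (metis add.assoc le_add_diff_inverse less_imp_le oddE)
      then have "tri_pair (int k - int m, k) = (fold_int (-1 - int l), fold_int (int m))"
        unfolding tri_pair_def by (auto intro!: arg_cong[where f = fold_int])
      then show ?thesis
        by (metis fold_int_of_nat fold_int_neg rangeI)
    qed
  qed
  then show ?thesis
    by auto
qed

text \<open>Only solutions of \<open>P\<close> have to be reached by \<open>f\<close>, so a
  congruence that fixes the parity of coordinates can supply the second hypothesis.\<close>

lemma card_Collect_reindex:
  assumes "inj f" and "\<And>y. P y \<Longrightarrow> y \<in> range f"
  shows "card {y. P y} = card {x. P (f x)}"
proof -
  have "{y. P y} \<subseteq> range f"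
    using assms(2) by blast
  from card_vimage_inj[OF assms(1) this] show ?thesis
    by simp
qed

lemma card_tri_add_tri:
  "card {(l :: nat, m :: nat, z). P (int (tri l) + int (tri m)) z}
     = card {(x :: int, k :: nat, z). P (x^2 + 2 * int (tri k)) z}"
proof -
  define f where "f = (\<lambda>(x, k, z :: 'a). case tri_pair (x, k) of (l, m) \<Rightarrow> (l, m, z))"
  have "inj f"
    by (rule injI)
      (auto simp: f_def split: prod.splits; metis injD[OF inj_tri_pair] prod.inject)
  moreover have "y \<in> range f" for y
  proof -
    obtain l m z where y: "y = (l, m, z)"
      by (metis prod_cases3)
    obtain x k where "tri_pair (x, k) = (l, m)"
      using surj_tri_pair by (metis surjD surj_pair)
    then have "y = f (x, k, z)"
      by (simp add: f_def y)
    then show ?thesis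
      by blast
  qed
  ultimately show ?thesis
    by (subst card_Collect_reindex[of f])
      (auto simp: f_def tri_add_tri_pair split: prod.splits intro!: arg_cong[where f = card])
qed

lemma card_rotate: "card {(l, m, n). P l m n} = card {(m, n, l). P l m n}"
  by (rule bij_betw_same_card[of "\<lambda>(l, m, n). (m, n, l)"])
    (force simp: bij_betw_def inj_on_def)

lemma T_eq_Rt: "T 1 1 2 N = Rt 1 2 4 N"
proof -
  have "T 1 1 2 N = card {(l, m, n). int N = (int (tri l) + int (tri m)) + 2 * int (tri n)}"
    unfolding T_def by (intro arg_cong[where f = card]) auto
  also have "\<dots> = card {(x, k, n). int N = (x^2 + 2 * int (tri k)) + 2 * int (tri n)}"
    by (rule card_tri_add_tri)
  \<comment> \<open>The two triangular indices, now with equal coefficients, move to the front so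
    that \<open>card_tri_add_tri\<close> applies again.\<close>
  also have "\<dots> = card {(k, n, x). int N = (x^2 + 2 * int (tri k)) + 2 * int (tri n)}"
    by (rule card_rotate)
  also have "\<dots> = card {(k, n, x). int N = x^2 + 2 * (int (tri k) + int (tri n))}"
    by (simp add: algebra_simps)
  also have "\<dots> = card {(y, k, x). int N = x^2 + 2 * (y^2 + 2 * int (tri k))}"
    by (rule card_tri_add_tri)
  also have "\<dots> = card {(x, y, k). int N = x^2 + 2 * (y^2 + 2 * int (tri k))}"
    by (rule card_rotate[symmetric])
  also have "\<dots> = Rt 1 2 4 N"
    unfolding Rt_def by (simp add: algebra_simps)
  finally show ?thesis .
qed

text \<open>Odd integers are indexed by sign and size, which gives the term 2 q psi(q^8) of phi(q);
  the sign accounts for the factor 2.\<close>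

definition signed_odd :: "bool \<Rightarrow> nat \<Rightarrow> int" where
  "signed_odd b k = (if b then 2 * int k + 1 else - (2 * int k + 1))"

lemma signed_odd_eq_iff: "signed_odd b k = signed_odd c j \<longleftrightarrow> b = c \<and> k = j"
  by (auto simp: signed_odd_def)

lemma signed_odd_square: "(signed_odd b k)^2 = 8 * int (tri k) + 1"
  using two_tri[of k] by (simp add: signed_odd_def power2_eq_square algebra_simps)

lemma odd_imp_signed_odd:
  assumes "odd x"
  obtains b k where "x = signed_odd b k"
proof -
  obtain y where "x = 2 * y + 1"
    using assms by (elim oddE)
  then have "x = signed_odd (0 \<le> y) (fold_int y)"
    by (auto simp: signed_odd_def fold_int_def)
  then show ?thesis
    by (rule that)
qed

lemma int_even_or_signed_odd:
  obtains (even) a where "x = 2 * a" | (odd) b k where "x = signed_odd b k"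
  by (metis evenE odd_imp_signed_odd)

text \<open>Modulo 4, the value of \<open>x^2 + 2 * y^2\<close> is 0, 1, 2 or 3 according to the
  parities of \<open>x\<close> and \<open>y\<close>, so each residue class admits exactly one parity
  pattern; here both are even.\<close>

lemma Rt_mult_4: "Rt 1 2 4 (4 * N) = Rt 1 2 1 N"
proof -
  let ?f = "\<lambda>(x :: int, y :: int, n :: nat). (2 * x, 2 * y, n)"
  have "(x, y, n) \<in> range ?f" if "int (4 * N) = x^2 + 2 * y^2 + 4 * int (tri n)" for x y n
    using that
    by (cases x rule: int_even_or_signed_odd; cases y rule: int_even_or_signed_odd)
      (simp add: signed_odd_square power_mult_distrib image_iff; presburger)+
  then show ?thesis
    unfolding Rt_def
    by (subst card_Collect_reindex[of ?f])
      (auto simp: inj_def power_mult_distrib intro!: arg_cong[where f = card])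
qed

lemma Rt_mult_4_add_1: "Rt 1 2 4 (4 * N + 1) = 2 * rT 2 1 2 N"
proof -
  \<comment> \<open>Here \<open>x\<close> is odd and \<open>y\<close> even. The equation does not
    depend on the sign \<open>b\<close>, so the preimage is a product with
    \<open>UNIV\<close>.\<close>
  let ?f = "\<lambda>(b, y :: int, n :: nat, k). (signed_odd b k, 2 * y, n)"
  have "(x, y, n) \<in> range ?f" if "int (4 * N + 1) = x^2 + 2 * y^2 + 4 * int (tri n)" for x y n
    using that
    by (cases x rule: int_even_or_signed_odd; cases y rule: int_even_or_signed_odd)
      (simp add: signed_odd_square power_mult_distrib image_iff signed_odd_eq_iff; presburger)+
  then have "Rt 1 2 4 (4 * N + 1) = card ((UNIV :: bool set) \<times>
      {(y :: int, n, k). int N = 2 * y^2 + int (tri n) + 2 * int (tri k)})"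
    unfolding Rt_def
    by (subst card_Collect_reindex[of ?f])
      (auto simp: inj_def power_mult_distrib signed_odd_square signed_odd_eq_iff
        intro!: arg_cong[where f = card])
  then show ?thesis
    by (simp add: rT_def card_cartesian_product)
qed

lemma Rt_mult_4_add_2: "Rt 1 2 4 (4 * N + 2) = 2 * rT 1 1 4 N"
proof -
  let ?f = "\<lambda>(b, x :: int, n :: nat, k). (2 * x, signed_odd b k, n)"
  have "(x, y, n) \<in> range ?f" if "int (4 * N + 2) = x^2 + 2 * y^2 + 4 * int (tri n)" for x y n
    using that
    by (cases x rule: int_even_or_signed_odd; cases y rule: int_even_or_signed_odd)
      (simp add: signed_odd_square power_mult_distrib image_iff signed_odd_eq_iff; presburger)+
  then have "Rt 1 2 4 (4 * N + 2) = card ((UNIV :: bool set) \<times>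
      {(x :: int, n, k). int N = x^2 + int (tri n) + 4 * int (tri k)})"
    unfolding Rt_def
    by (subst card_Collect_reindex[of ?f])
      (auto simp: inj_def power_mult_distrib signed_odd_square signed_odd_eq_iff
        intro!: arg_cong[where f = card])
  then show ?thesis
    by (simp add: rT_def card_cartesian_product)
qed

lemma Rt_mult_4_add_3: "Rt 1 2 4 (4 * N + 3) = 4 * T 1 2 4 N"
proof -
  \<comment> \<open>Both squares are odd, and their two independent signs give the factor 4.\<close>
  let ?f = "\<lambda>((b, c), n :: nat, j, k). (signed_odd b j, signed_odd c k, n)"
  have "(x, y, n) \<in> range ?f" if "int (4 * N + 3) = x^2 + 2 * y^2 + 4 * int (tri n)" for x y n
    using that
    by (cases x rule: int_even_or_signed_odd; cases y rule: int_even_or_signed_odd)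
      (simp add: signed_odd_square power_mult_distrib image_iff signed_odd_eq_iff; presburger)+
  then have "Rt 1 2 4 (4 * N + 3) = card ((UNIV :: (bool \<times> bool) set) \<times>
      {(n, j, k). N = tri n + 2 * tri j + 4 * tri k})"
    unfolding Rt_def
    by (subst card_Collect_reindex[of ?f])
      (auto simp: inj_def signed_odd_square signed_odd_eq_iff intro!: arg_cong[where f = card])
  then show ?thesis
    by (simp add: T_def card_cartesian_product flip: UNIV_Times_UNIV)
qed

lemma r_mult_2: "r 1 2 4 (2 * N) = r 1 2 2 N"
proof -
  \<comment> \<open>Parity makes the first coordinate even; after halving the equation,
    \<open>y\<close> carries coefficient 1 and so comes first.\<close>
  let ?f = "\<lambda>(y :: int, x :: int, z :: int). (2 * x, y, z)"
  have "(x, y, z) \<in> range ?f" if "int (2 * N) = x^2 + 2 * y^2 + 4 * z^2" for x y z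
    using that
    by (cases x rule: int_even_or_signed_odd)
      (simp add: signed_odd_square power_mult_distrib image_iff; presburger)+
  then show ?thesis
    unfolding r_def
    by (subst card_Collect_reindex[of ?f])
      (auto simp: inj_def power_mult_distrib intro!: arg_cong[where f = card])
qed

text \<open>The count is stated through \<open>Rt 1 2 4 N\<close>, the form that
  \<open>T 1 1 2 N\<close> takes after rewriting with \<open>T_eq_Rt\<close>.\<close>

lemma r_mult_2_add_1: "r 1 2 4 (2 * N + 1) = 2 * Rt 1 2 4 N"
proof -
  let ?f = "\<lambda>(b, y :: int, z :: int, k). (signed_odd b k, y, z)"
  have "(x, y, z) \<in> range ?f" if "int (2 * N + 1) = x^2 + 2 * y^2 + 4 * z^2" for x y z
    using that
    by (cases x rule: int_even_or_signed_odd)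
      (simp add: signed_odd_square power_mult_distrib image_iff signed_odd_eq_iff; presburger)+
  then have "r 1 2 4 (2 * N + 1) = card ((UNIV :: bool set) \<times>
      {(y :: int, z :: int, k). int N = y^2 + 2 * z^2 + 4 * int (tri k)})"
    unfolding r_def
    by (subst card_Collect_reindex[of ?f])
      (auto simp: inj_def signed_odd_square signed_odd_eq_iff intro!: arg_cong[where f = card])
  then show ?thesis
    by (simp add: Rt_def card_cartesian_product)
qed

theorem theorem5p8:
  fixes N :: nat
  shows "T 1 1 2 (4 * N) = Rt 1 2 1 N
       \<and> T 1 1 2 (4 * N + 1) = 2 * rT 2 1 2 N
       \<and> T 1 1 2 (4 * N + 2) = 2 * rT 1 1 4 N
       \<and> T 1 1 2 (4 * N + 3) = 4 * T 1 2 4 N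
       \<and> r 1 2 4 (2 * N) = r 1 2 2 N
       \<and> r 1 2 4 (2 * N + 1) = 2 * T 1 1 2 N"
  unfolding T_eq_Rt
  by (intro conjI Rt_mult_4 Rt_mult_4_add_1 Rt_mult_4_add_2 Rt_mult_4_add_3
      r_mult_2 r_mult_2_add_1)

end
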